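(* Let $\mu(\mathfrak r)$ and $\mu(2\mathfrak r)$ be laws in a Meixner class $\mathcal M(\mathfrak u)$. Suppose $\mu(2\mathfrak r)=\nu*\nu$ for a probability law $\nu$ on $\mathbb R$ with $\nu\ll\mu(\mathfrak r)$, and suppose that the Radon–Nikodym derivative $d\nu/d\mu(\mathfrak r)$ is square integrable with respect to $\mu(\mathfrak r)$. Then $\nu=\mu(\mathfrak r)\in\mathcal M(\mathfrak u)$.
   Context: Meixner classes. Let $\mathfrak u$ be a real function with a power series expansion near $0$, $\mathfrak u(0)=0$, $\mathfrak u'(0)=1$. The Meixner class $\mathcal M(\mathfrak u)$ is the set of probability laws $\mu$ on $\mathbb R$ with positive variance, whose moment generating function $M(t)=\int e^{tx}\mu(dx)$ is finite in an open interval containing $0$, and such that the polynomials $P_n$ (monic of degree $n$) defined by $\frac{e^{x\mathfrak u(z)}}{M(\mathfrak u(z))}=\sum_{n\ge0}P_n(x)\frac{z^n}{n!}$ for $z$ near $0$ are orthogonal: $\int P_mP_n\,d\mu=0$ for $m\ne n$. With $\mathfrak v$ the inverse of $\mathfrak u$ near $0$, one has $M'(t)/M(t)=\mathfrak s^2\mathfrak v(t)+\mathfrak m$, where $\mathfrak m,\mathfrak s^2$ are the mean and variance of $\mu$; hence a law in $\mathcal M(\mathfrak u)$ is determined by $\mathfrak r=(\mathfrak m,\mathfrak s^2)$ and is denoted $\mu(\mathfrak r)$. Here $2\mathfrak r=(2\mathfrak m,2\mathfrak s^2)$. It is known that $(P_n)_n$ is a complete orthogonal system in $L^2(\mu)$,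 and that if $\mu(\mathfrak r_1),\mu(\mathfrak r_2)\in\mathcal M(\mathfrak u)$ then $\mu(\mathfrak r_1)*\mu(\mathfrak r_2)=\mu(\mathfrak r_1+\mathfrak r_2)\in\mathcal M(\mathfrak u)$. *)

theory Defs
  imports "HOL-Probability.Probability"
begin

definition mgf :: "real measure \<Rightarrow> real \<Rightarrow> real" where
  "mgf \<mu> t = (LINT x|\<mu>. exp (t * x))"

text \<open>The pair of mean and variance; meaningful for laws whose moment generating function
  is finite near 0.\<close>

definition meixner_param :: "real measure \<Rightarrow> real \<times> real" where
  "meixner_param \<mu> =
    (prob_space.expectation \<mu> (\<lambda>x. x), prob_space.variance \<mu> (\<lambda>x. x))"

text \<open>The family \<open>P\<close> below is unique, since a power series expansion at 0 is unique, so
  quantifying over it existentially does not enlarge the class. The generating identity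
  is required for each \<open>x\<close>, with a neighbourhood of \<open>z = 0\<close> that may depend on \<open>x\<close>.\<close>

definition meixner_class :: "(real \<Rightarrow> real) \<Rightarrow> real measure set" where
  "meixner_class u = {\<mu>. real_distribution \<mu> \<and>
     (\<exists>\<epsilon>>0. \<forall>t. \<bar>t\<bar> < \<epsilon> \<longrightarrow> integrable \<mu> (\<lambda>x. exp (t * x))) \<and>
     prob_space.variance \<mu> (\<lambda>x. x) > 0 \<and>
     (\<exists>P :: nat \<Rightarrow> real poly.
        (\<forall>n. degree (P n) = n \<and> lead_coeff (P n) = 1) \<and>
        (\<forall>x. (\<lambda>z. exp (x * u z) / mgf \<mu> (u z))
               has_fps_expansion Abs_fps (\<lambda>n. poly (P n) x / fact n)) \<and>
        (\<forall>m n. m \<noteq> n \<longrightarrow> (LINT x|\<mu>. poly (P m) x * poly (P n) x) = 0))}"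

end

theory Submission
  imports Defs
begin

text \<open>Integrating the generating function of \<open>P\<^sub>n\<close> against \<open>P\<^sub>0\<close> and \<open>P\<^sub>1\<close> coefficientwise gives,
  as formal power series, \<open>M' / M = \<sigma>\<^sup>2 v + m\<close> with \<open>v\<close> the inverse of \<open>u\<close>; hence the moment
  generating series of \<open>\<mu>\<^sub>2\<close> is the square of that of \<open>\<mu>\<^sub>1\<close>. Exponential moments of \<open>\<nu> \<star> \<nu>\<close>
  force exponential moments of \<open>\<nu>\<close>, and its moment generating series squares to the same series.
  Both roots have constant term \<open>1\<close>, so \<open>\<nu>\<close> and \<open>\<mu>\<^sub>1\<close> have the same moments, and exponential
  moments make the moment problem determinate.\<close>

section \<open>Power series expansions and formal linear differential equations\<close>

text \<open>Dividing the zero function by the leading power of a nonzero difference series would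
  give a function that vanishes away from 0 but is continuous at 0 with the nonzero leading
  coefficient as its value.\<close>

lemma fps_expansion_unique:
  fixes F G :: "'a :: {banach, real_normed_field} fps"
  assumes "f has_fps_expansion F" "f has_fps_expansion G"
  shows "F = G"
proof (rule ccontr)
  assume "F \<noteq> G"
  define D where "D = F - G"
  have D: "(\<lambda>_. 0) has_fps_expansion D"
    using has_fps_expansion_diff[OF assms] by (simp add: D_def)
  define c where "c = fps_nth D (subdegree D)"
  have "D \<noteq> 0"
    using \<open>F \<noteq> G\<close> by (simp add: D_def)
  then have "c \<noteq> 0"
    by (simp add: c_def)
  have "(\<lambda>x. if x = 0 then c else 0 / x ^ subdegree D) has_fps_expansion fps_shift (subdegree D) D"
    by (intro has_fps_expansion_shift[OF D]) (auto simp: c_def)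
  then have "((\<lambda>x. if x = 0 then c else 0 / x ^ subdegree D) \<longlongrightarrow> c) (at 0)"
    by (auto dest!: has_fps_expansion_imp_continuous[where A = UNIV] simp: continuous_within)
  moreover have "((\<lambda>x. if x = 0 then c else 0 / x ^ subdegree D) \<longlongrightarrow> 0) (at 0)"
    by (rule tendsto_eventually) (auto simp: eventually_at_filter)
  ultimately show False
    using \<open>c \<noteq> 0\<close> tendsto_unique[OF at_neq_bot] by blast
qed

lemma has_fps_expansion_cong:
  assumes "eventually (\<lambda>x. f x = g x) (nhds 0)" "f has_fps_expansion F"
  shows "g has_fps_expansion F"
proof -
  have "eventually (\<lambda>x. eval_fps F x = f x) (nhds 0)"
    using assms(2) by (simp add: has_fps_expansion_def)
  with assms(1) have "eventually (\<lambda>x. eval_fps F x = g x) (nhds 0)"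
    by eventually_elim simp
  with assms(2) show ?thesis
    by (simp add: has_fps_expansion_def)
qed

lemma has_fps_expansion_at_0:
  assumes "f has_fps_expansion F"
  shows "fps_nth F 0 = f 0"
  using assms
  by (auto simp: has_fps_expansion_def eval_fps_at_0 dest: eventually_nhds_x_imp_x)

text \<open>A function with an expansion agrees with the series on a whole neighbourhood of every
  point near 0, so differentiability carries over from the series at those points too.\<close>

lemma has_fps_expansion_imp_eventually_has_deriv:
  fixes f :: "'a :: {banach, real_normed_field} \<Rightarrow> 'a"
  assumes "f has_fps_expansion F"
  shows "eventually (\<lambda>z. (f has_field_derivative deriv f z) (at z)) (nhds 0)"
proof -
  have "eventually (\<lambda>z. z \<in> eball 0 (fps_conv_radius F)) (nhds 0)"
    using assms by (intro eventually_nhds_in_open)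
                   (auto simp: has_fps_expansion_def zero_ereal_def)
  moreover have "eventually (\<lambda>y. eventually (\<lambda>z. eval_fps F z = f z) (nhds y)) (nhds 0)"
    using assms by (simp add: has_fps_expansion_def eventually_eventually)
  ultimately show ?thesis
  proof eventually_elim
    case (elim z)
    then have "(eval_fps F has_field_derivative eval_fps (fps_deriv F) z) (at z)"
      by (intro has_field_derivative_eval_fps) auto
    then have "(f has_field_derivative eval_fps (fps_deriv F) z) (at z)"
      using elim(2) by (simp cong: DERIV_cong_ev)
    then show ?case
      by (metis DERIV_imp_deriv)
  qed
qed

text \<open>The quotient of two solutions has derivative 0, hence is constant in characteristic 0,
  and the constant is 1.\<close>

lemma fps_linear_ode_unique:
  fixes A B C :: "'a :: field_char_0 fps"
  assumes "fps_deriv A = C * A" "fps_deriv B = C * B"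
    and "fps_nth A 0 = fps_nth B 0" "fps_nth B 0 \<noteq> 0"
  shows "A = B"
proof -
  have "fps_deriv (A * inverse B) = 0"
    using assms(4) inverse_mult_eq_1[OF assms(4)]
    by (simp add: fps_inverse_deriv assms(1,2) power2_eq_square algebra_simps)
  then have "A * inverse B = fps_const (fps_nth (A * inverse B) 0)"
    by (simp only: fps_deriv_eq_0_iff)
  also have "\<dots> = 1"
    using assms by simp
  finally have "A * inverse B * B = B"
    by simp
  then show ?thesis
    using inverse_mult_eq_1[OF assms(4)] by (simp add: mult.assoc)
qed

text \<open>Both series solve \<open>Y' = x U' Y\<close> with constant term 1. This turns the
  analytic composition \<open>exp (x * u z)\<close> into a formal one.\<close>

lemma has_fps_expansion_exp_compose:
  fixes u :: "real \<Rightarrow> real"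
  assumes u: "u has_fps_expansion U" and u0: "u 0 = 0"
    and E: "(\<lambda>z. exp (x * u z)) has_fps_expansion E"
  shows "E = fps_exp x oo U"
proof (rule fps_linear_ode_unique)
  have U0: "fps_nth U 0 = 0"
    using has_fps_expansion_at_0[OF u] u0 by simp
  have "eventually (\<lambda>z. deriv (\<lambda>z. exp (x * u z)) z = x * deriv u z * exp (x * u z)) (nhds 0)"
    using has_fps_expansion_imp_eventually_has_deriv[OF u]
    by eventually_elim (auto intro!: DERIV_imp_deriv derivative_eq_intros)
  then have "(\<lambda>z. x * deriv u z * exp (x * u z)) has_fps_expansion fps_deriv E"
    by (rule has_fps_expansion_cong) (rule has_fps_expansion_deriv[OF E])
  moreover have "(\<lambda>z. x * deriv u z * exp (x * u z)) has_fps_expansion fps_const x * fps_deriv U * E"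
    by (intro has_fps_expansion_mult has_fps_expansion_const has_fps_expansion_deriv u E)
  ultimately show "fps_deriv E = fps_const x * fps_deriv U * E"
    by (rule fps_expansion_unique)
  show "fps_deriv (fps_exp x oo U) = fps_const x * fps_deriv U * (fps_exp x oo U)"
    by (simp add: fps_compose_deriv[OF U0] fps_compose_mult_distrib[OF U0] mult_ac)
  show "fps_nth E 0 = fps_nth (fps_exp x oo U) 0"
    using has_fps_expansion_at_0[OF E] u0 by simp
qed simp

section \<open>Exponential moments and termwise integration\<close>

text \<open>The power is absorbed by one term of the series of
  \<open>exp (d * \<bar>x\<bar>)\<close>, and an exponential of \<open>\<bar>x\<bar>\<close> is at
  most the sum of the exponentials of both signs.\<close>

lemma abs_power_mult_exp_le:
  fixes x c d :: real
  assumes "0 < d"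
  shows "\<bar>x\<bar> ^ k * exp (c * \<bar>x\<bar>) \<le> fact k / d ^ k * (exp ((c + d) * x) + exp (- (c + d) * x))"
proof -
  have "(d * \<bar>x\<bar>) ^ k / fact k = (\<Sum>n\<in>{k}. (d * \<bar>x\<bar>) ^ n /\<^sub>R fact n)"
    by (simp add: field_simps)
  also have "\<dots> \<le> exp (d * \<bar>x\<bar>)"
    unfolding exp_def using assms
    by (intro sum_le_suminf summable_exp_generic) auto
  finally have "\<bar>x\<bar> ^ k \<le> fact k / d ^ k * exp (d * \<bar>x\<bar>)"
    using assms by (simp add: field_simps power_mult_distrib)
  then have "\<bar>x\<bar> ^ k * exp (c * \<bar>x\<bar>) \<le> fact k / d ^ k * exp (d * \<bar>x\<bar>) * exp (c * \<bar>x\<bar>)"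
    by (intro mult_right_mono) auto
  also have "\<dots> = fact k / d ^ k * exp ((c + d) * \<bar>x\<bar>)"
    by (simp add: exp_add[symmetric] algebra_simps)
  also have "\<dots> \<le> fact k / d ^ k * (exp ((c + d) * x) + exp (- (c + d) * x))"
    using assms
    by (intro mult_left_mono; cases "0 \<le> x")
       (auto simp: algebra_simps add_increasing add_increasing2)
  finally show ?thesis .
qed

text \<open>The radius is a parameter, so that two laws can be compared on one common
  interval.\<close>

locale exp_moments = real_distribution \<mu> for \<mu> :: "real measure" +
  fixes \<epsilon> :: real
  assumes eps_pos: "0 < \<epsilon>"
    and integrable_exp: "\<bar>t\<bar> < \<epsilon> \<Longrightarrow> integrable \<mu> (\<lambda>x. exp (t * x))"
begin

lemma integrable_power_exp:
  assumes "0 \<le> c" "c < \<epsilon>"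
  shows "integrable \<mu> (\<lambda>x. \<bar>x\<bar> ^ k * exp (c * \<bar>x\<bar>))"
proof (rule Bochner_Integration.integrable_bound)
  \<comment> \<open>Half of the gap between \<open>c\<close> and \<open>\<epsilon>\<close>, so that
    the exponents \<open>c + d\<close> and \<open>- (c + d)\<close> stay inside the
    interval.\<close>
  define d where "d = (\<epsilon> - c) / 2"
  have d: "0 < d" "c + d < \<epsilon>"
    using assms by (auto simp: d_def field_simps)
  show "integrable \<mu> (\<lambda>x. fact k / d ^ k * (exp ((c + d) * x) + exp (- (c + d) * x)))"
    using assms d by (intro integrable_mult_right Bochner_Integration.integrable_add integrable_exp) auto
  show "AE x in \<mu>. norm (\<bar>x\<bar> ^ k * exp (c * \<bar>x\<bar>))
      \<le> norm (fact k / d ^ k * (exp ((c + d) * x) + exp (- (c + d) * x)))"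
    using abs_power_mult_exp_le[OF d(1)] d
    by (intro AE_I2) (smt (verit) real_norm_def zero_le_mult_iff exp_ge_zero zero_le_power abs_ge_zero)
qed simp

lemma integrable_power: "integrable \<mu> (\<lambda>x. x ^ k)"
  by (rule Bochner_Integration.integrable_bound[OF integrable_power_exp[of 0 k]])
     (use eps_pos in \<open>auto simp: power_abs\<close>)

text \<open>Expands the exponential under the integral, with the majorant
  \<open>\<bar>x\<bar> ^ k * exp (norm h * \<bar>x\<bar>)\<close>. The scalar field is left open:
  real \<open>h\<close> gives the moment generating function, imaginary \<open>h\<close> a Taylor
  step for characteristic functions, where \<open>g\<close> holds the factors already
  present.\<close>

lemma sums_moments:
  fixes g :: "real \<Rightarrow> 'a :: {real_normed_field, banach, second_countable_topology}" and h :: 'a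
  assumes [measurable]: "g \<in> borel_measurable borel"
    and g: "\<And>x. norm (g x) \<le> \<bar>x\<bar> ^ k"
    and h: "norm h < \<epsilon>"
  shows "(\<lambda>n. h ^ n / fact n * (LINT x|\<mu>. of_real x ^ n * g x))
           sums (LINT x|\<mu>. exp (h * of_real x) * g x)"
proof -
  define f where "f n x = h ^ n / fact n * (of_real x ^ n * g x)" for n x
  have meas: "f n \<in> borel_measurable \<mu>" for n
    unfolding f_def by measurable
  have norm_f: "norm (f n x) \<le> (norm h * \<bar>x\<bar>) ^ n /\<^sub>R fact n * \<bar>x\<bar> ^ k" for n x
    using mult_left_mono[OF g, of "(norm h * \<bar>x\<bar>) ^ n /\<^sub>R fact n" x]
    by (simp add: f_def norm_mult norm_divide norm_power power_mult_distrib field_simps)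
  have sums_exp: "(\<lambda>n. (norm h * \<bar>x\<bar>) ^ n /\<^sub>R fact n * \<bar>x\<bar> ^ k) sums (exp (norm h * \<bar>x\<bar>) * \<bar>x\<bar> ^ k)" for x
    by (intro sums_mult2 exp_converges)
  have partial: "(\<Sum>i<n. norm (f i x)) \<le> \<bar>x\<bar> ^ k * exp (norm h * \<bar>x\<bar>)" for n x
  proof -
    have "(\<Sum>i<n. norm (f i x)) \<le> (\<Sum>i<n. (norm h * \<bar>x\<bar>) ^ i /\<^sub>R fact i * \<bar>x\<bar> ^ k)"
      by (intro sum_mono norm_f)
    also have "\<dots> \<le> exp (norm h * \<bar>x\<bar>) * \<bar>x\<bar> ^ k"
      using sums_exp[of x] by (intro sum_le_suminf[THEN order_trans]) (auto simp: sums_iff)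
    finally show ?thesis
      by (simp add: mult.commute)
  qed
  have dom: "integrable \<mu> (\<lambda>x. \<bar>x\<bar> ^ k * exp (norm h * \<bar>x\<bar>))"
    using h by (intro integrable_power_exp) auto
  have int: "integrable \<mu> (f n)" for n
  proof (rule Bochner_Integration.integrable_bound[OF dom meas], rule AE_I2)
    fix x
    have "norm (f n x) \<le> (\<Sum>i<Suc n. norm (f i x))"
      by (simp add: sum_nonneg)
    also have "\<dots> \<le> \<bar>x\<bar> ^ k * exp (norm h * \<bar>x\<bar>)"
      by (rule partial)
    finally show "norm (f n x) \<le> norm (\<bar>x\<bar> ^ k * exp (norm h * \<bar>x\<bar>))"
      by simp
  qed
  have "(\<lambda>n. integral\<^sup>L \<mu> (f n)) sums (LINT x|\<mu>. (\<Sum>n. f n x))"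
  proof (rule sums_integral[OF int])
    show "AE x in \<mu>. summable (\<lambda>n. norm (f n x))"
      using partial by (intro AE_I2 summableI_nonneg_bounded[where x = "\<bar>_\<bar> ^ k * exp (norm h * \<bar>_\<bar>)"]) auto
    \<comment> \<open>The partial sums of these nonnegative integrals are bounded by the integral of
      the majorant.\<close>
    show "summable (\<lambda>n. LINT x|\<mu>. norm (f n x))"
    proof (rule summableI_nonneg_bounded)
      fix n
      have "(\<Sum>i<n. LINT x|\<mu>. norm (f i x)) = (LINT x|\<mu>. (\<Sum>i<n. norm (f i x)))"
        using int by (subst Bochner_Integration.integral_sum) auto
      also have "\<dots> \<le> (LINT x|\<mu>. \<bar>x\<bar> ^ k * exp (norm h * \<bar>x\<bar>))"
        using int dom partial by (intro integral_mono) auto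
      finally show "(\<Sum>i<n. LINT x|\<mu>. norm (f i x)) \<le> (LINT x|\<mu>. \<bar>x\<bar> ^ k * exp (norm h * \<bar>x\<bar>))" .
    qed simp
  qed
  moreover have "(\<Sum>n. f n x) = exp (h * of_real x) * g x" for x
  proof -
    have "(\<lambda>n. (h * of_real x) ^ n /\<^sub>R fact n * g x) sums (exp (h * of_real x) * g x)"
      by (intro sums_mult2 exp_converges)
    moreover have "(\<lambda>n. (h * of_real x) ^ n /\<^sub>R fact n * g x) = (\<lambda>n. f n x)"
      by (simp add: f_def power_mult_distrib scaleR_conv_of_real field_simps)
    ultimately show ?thesis
      by (simp add: sums_iff)
  qed
  moreover have "integral\<^sup>L \<mu> (f n) = h ^ n / fact n * (LINT x|\<mu>. of_real x ^ n * g x)" for n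
    unfolding f_def[abs_def] by (rule integral_mult_right_zero)
  ultimately show ?thesis
    by simp
qed

end

section \<open>Moment series and determinacy of the law\<close>

definition moment_fps :: "real measure \<Rightarrow> real fps" where
  "moment_fps \<mu> = Abs_fps (\<lambda>n. (LINT x|\<mu>. x ^ n) / fact n)"

lemma (in exp_moments) mgf_has_fps_expansion: "mgf \<mu> has_fps_expansion moment_fps \<mu>"
proof (rule has_fps_expansionI)
  have "eventually (\<lambda>t. t \<in> ball 0 \<epsilon>) (nhds (0::real))"
    using eps_pos by (intro eventually_nhds_in_open) auto
  then show "eventually (\<lambda>t. (\<lambda>n. fps_nth (moment_fps \<mu>) n * t ^ n) sums mgf \<mu> t) (nhds 0)"
  proof eventually_elim
    case (elim t)
    then show ?case
      using sums_moments[of "\<lambda>_. 1 :: real" 0 t] by (simp add: mgf_def moment_fps_def mult.commute)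
  qed
qed

text \<open>The characteristic function and all its derivatives are continued from \<open>0\<close> to the
  whole line in steps of length at most \<open>\<epsilon> / 2\<close>.\<close>

lemma exp_moments_eqI:
  assumes "exp_moments \<mu> \<epsilon>" "exp_moments \<nu> \<epsilon>"
    and eq: "moment_fps \<mu> = moment_fps \<nu>"
  shows "\<mu> = \<nu>"
proof -
  interpret \<mu>: exp_moments \<mu> \<epsilon> by fact
  interpret \<nu>: exp_moments \<nu> \<epsilon> by fact
  have moments: "(LINT x|\<mu>. x ^ n) = (LINT x|\<nu>. x ^ n)" for n
    using arg_cong[OF eq, of "\<lambda>F. fps_nth F n"] by (simp add: moment_fps_def)
  have "(LINT x|\<mu>. complex_of_real x ^ k * iexp (t * x)) = (LINT x|\<nu>. complex_of_real x ^ k * iexp (t * x))"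
    if "\<bar>t\<bar> \<le> real N * (\<epsilon> / 2)" for N t k
    using that
  proof (induction N arbitrary: t k)
    case 0
    then show ?case
      using moments[of k] by (simp flip: of_real_power)
  next
    case (Suc N)
    \<comment> \<open>The point \<open>s\<close> lies the fraction \<open>N / (N + 1)\<close> of the
      way to \<open>t\<close>: it is within reach of the induction hypothesis, and the remaining
      step is at most \<open>\<epsilon> / 2\<close>. The expansion around \<open>s\<close> involves
      all derivatives there, hence the arbitrary \<open>k\<close>.\<close>
    define s where "s = t * (real N / real (Suc N))"
    define h where "h = \<i> * complex_of_real (t - s)"
    have "\<bar>s\<bar> = \<bar>t\<bar> * (real N / real (Suc N))"
      by (simp add: s_def abs_mult)
    also have "\<dots> \<le> real (Suc N) * (\<epsilon> / 2) * (real N / real (Suc N))"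
      using Suc.prems by (intro mult_right_mono) auto
    also have "\<dots> = real N * (\<epsilon> / 2)"
      by (simp add: field_simps del: of_nat_Suc)
    finally have s: "\<bar>s\<bar> \<le> real N * (\<epsilon> / 2)" .
    have "t - s = t / real (Suc N)"
      by (simp add: s_def field_simps)
    then have "\<bar>t - s\<bar> \<le> \<epsilon> / 2"
      using Suc.prems
      by (simp add: abs_divide pos_divide_le_eq mult.commute del: of_nat_Suc)
    then have h: "norm h < \<epsilon>"
      using \<mu>.eps_pos by (simp only: h_def norm_mult norm_of_real) simp
    define g where "g x = complex_of_real x ^ k * iexp (s * x)" for x
    have g: "g \<in> borel_measurable borel" "norm (g x) \<le> \<bar>x\<bar> ^ k" for x
      unfolding g_def[abs_def] by (measurable, simp add: norm_mult norm_power)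
    have eq: "exp (h * of_real x) * g x = complex_of_real x ^ k * iexp (t * x)" for x
      by (simp add: g_def h_def exp_add[symmetric] mult_ac) (simp add: algebra_simps)
    have "complex_of_real x ^ n * g x = complex_of_real x ^ (n + k) * iexp (s * x)" for n x
      by (simp add: g_def power_add)
    then have "(LINT x|\<mu>. of_real x ^ n * g x) = (LINT x|\<nu>. of_real x ^ n * g x)" for n
      using Suc.IH[OF s, of "n + k"] by simp
    then show ?case
      using \<mu>.sums_moments[OF g h] \<nu>.sums_moments[OF g h] sums_unique2 unfolding eq by auto
  qed
  \<comment> \<open>The case \<open>k = 0\<close> is the characteristic function itself.\<close>
  from this[of _ _ 0] have "char \<mu> t = char \<nu> t" if "\<bar>t\<bar> \<le> real N * (\<epsilon> / 2)" for t N
    using that by (simp add: char_def)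
  moreover have "\<exists>N. \<bar>t\<bar> \<le> real N * (\<epsilon> / 2)" for t
    using real_arch_simple[of "\<bar>t\<bar> / (\<epsilon> / 2)"] \<mu>.eps_pos by (simp add: field_simps)
  ultimately have "char \<mu> t = char \<nu> t" for t
    by blast
  then show ?thesis
    by (intro Levy_uniqueness ext \<mu>.real_distribution_axioms \<nu>.real_distribution_axioms)
qed


section \<open>The differential equation for moment series of Meixner laws\<close>

lemma (in exp_moments) integrable_poly: "integrable \<mu> (poly p)"
  unfolding poly_altdef by (intro Bochner_Integration.integrable_sum integrable_mult_right integrable_power)

text \<open>Each coefficient is a polynomial in \<open>x\<close>, so only finite sums are exchanged
  with the integral. The case \<open>j = 0\<close> produces \<open>moment_fps\<close>, the case
  \<open>j = 1\<close> its derivative.\<close>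

lemma (in exp_moments) integral_power_mult_fps_exp_compose:
  "Abs_fps (\<lambda>n. LINT x|\<mu>. x ^ j * fps_nth ((fps_exp x oo U) * G) n)
     = (Abs_fps (\<lambda>k. (LINT x|\<mu>. x ^ (k + j)) / fact k) oo U) * G"
proof (rule fps_ext)
  fix n
  have "(LINT x|\<mu>. x ^ j * fps_nth ((fps_exp x oo U) * G) n)
      = (LINT x|\<mu>. (\<Sum>i=0..n. \<Sum>k=0..i. x ^ (k + j) * (fps_nth (U ^ k) i * fps_nth G (n - i) / fact k)))"
    unfolding fps_mult_nth fps_compose_nth sum_distrib_left sum_distrib_right
    by (simp add: power_add mult_ac)
  also have "\<dots> = (\<Sum>i=0..n. \<Sum>k=0..i. (LINT x|\<mu>. x ^ (k + j)) * (fps_nth (U ^ k) i * fps_nth G (n - i) / fact k))"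
    by (simp only: Bochner_Integration.integral_sum Bochner_Integration.integrable_sum
          integrable_mult_left integrable_power integral_mult_left_zero)
  also have "\<dots> = fps_nth ((Abs_fps (\<lambda>k. (LINT x|\<mu>. x ^ (k + j)) / fact k) oo U) * G) n"
    unfolding fps_mult_nth fps_compose_nth sum_distrib_left sum_distrib_right
    by (simp add: mult_ac)
  finally show "fps_nth (Abs_fps (\<lambda>n. LINT x|\<mu>. x ^ j * fps_nth ((fps_exp x oo U) * G) n)) n
      = fps_nth ((Abs_fps (\<lambda>k. (LINT x|\<mu>. x ^ (k + j)) / fact k) oo U) * G) n"
    by simp
qed

lemma fps_deriv_moment_fps:
  "fps_deriv (moment_fps \<mu>) = Abs_fps (\<lambda>k. (LINT x|\<mu>. x ^ (k + 1)) / fact k)"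
  by (rule fps_ext) (simp add: moment_fps_def field_simps del: of_nat_Suc)

lemma meixner_class_exp_moments:
  assumes "\<mu> \<in> meixner_class u"
  obtains \<epsilon> where "exp_moments \<mu> \<epsilon>"
  using assms
  by (auto simp: meixner_class_def exp_moments_def exp_moments_axioms_def)

lemma exp_moments_mono:
  assumes "exp_moments \<mu> \<epsilon>" "0 < \<delta>" "\<delta> \<le> \<epsilon>"
  shows "exp_moments \<mu> \<delta>"
  using assms by (auto simp: exp_moments_def exp_moments_axioms_def)

text \<open>Formal version of \<open>M' / M = \<sigma>\<^sup>2 v + m\<close>, with \<open>t = u z\<close> substituted.\<close>

lemma meixner_class_moment_fps_deriv:
  assumes \<mu>: "\<mu> \<in> meixner_class u"
    and u: "u has_fps_expansion U" and u0: "u 0 = 0"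
    and r: "meixner_param \<mu> = (m, v)"
  shows "fps_deriv (moment_fps \<mu>) oo U = (fps_const m + fps_const v * fps_X) * (moment_fps \<mu> oo U)"
proof -
  obtain \<epsilon> where "exp_moments \<mu> \<epsilon>"
    using meixner_class_exp_moments[OF \<mu>] .
  then interpret exp_moments \<mu> \<epsilon> .
  obtain P :: "nat \<Rightarrow> real poly" where
    P: "\<And>n. degree (P n) = n" "\<And>n. lead_coeff (P n) = 1" and
    exp: "\<And>x. (\<lambda>z. exp (x * u z) / mgf \<mu> (u z))
               has_fps_expansion Abs_fps (\<lambda>n. poly (P n) x / fact n)" and
    orth: "\<And>k n. k \<noteq> n \<Longrightarrow> (LINT x|\<mu>. poly (P k) x * poly (P n) x) = 0"
    using \<mu> unfolding meixner_class_def by blast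
  have m: "m = (LINT x|\<mu>. x)" and v: "v = (LINT x|\<mu>. (x - m)\<^sup>2)"
    using r by (auto simp: meixner_param_def)
  have P0: "poly (P 0) x = 1" for x
    using P(2)[of 0] by (simp add: poly_altdef P(1))
  define c where "c = coeff (P 1) 0"
  have P1: "poly (P 1) x = x + c" for x
    using P(2)[of 1] by (simp add: poly_altdef P(1) c_def)
  \<comment> \<open>\<open>P 1\<close> is orthogonal to the constant \<open>P 0\<close>, so it has
    mean 0.\<close>
  have "c = - m"
  proof -
    have "0 = (LINT x|\<mu>. x + c)"
      using orth[of 0 1] by (simp only: P0 P1 mult_1)
    also have "\<dots> = m + c"
      using integrable_power[of 1] prob_space by (simp add: m)
    finally show ?thesis
      by simp
  qed
  note P1 = P1[unfolded this]
  have int_P: "(LINT x|\<mu>. poly (P n) x) = (if n = 0 then 1 else 0)" for n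
    using orth[of 0 n] prob_space by (auto simp: P0)
  \<comment> \<open>Writing \<open>x\<close> as \<open>P 1 + m\<close> leaves only the indices 0 and
    1.\<close>
  have int_xP: "(LINT x|\<mu>. x * poly (P n) x) = (if n = 0 then m else if n = 1 then v else 0)" for n
  proof -
    have "(LINT x|\<mu>. x * poly (P n) x) = (LINT x|\<mu>. poly (P 1) x * poly (P n) x + m * poly (P n) x)"
      by (intro Bochner_Integration.integral_cong) (auto simp: P1 algebra_simps simp del: One_nat_def)
    also have "\<dots> = (LINT x|\<mu>. poly (P 1) x * poly (P n) x) + m * (LINT x|\<mu>. poly (P n) x)"
      using integrable_poly[of "P 1 * P n"] integrable_poly[of "P n"] by (simp flip: poly_mult)
    also have "(LINT x|\<mu>. poly (P 1) x * poly (P n) x) = (if n = 1 then v else 0)"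
      using orth[of 1 n] by (auto simp: P1 v power2_eq_square simp del: One_nat_def)
    finally show ?thesis
      by (simp add: int_P)
  qed
  define H where "H x = Abs_fps (\<lambda>n. poly (P n) x / fact n)" for x
  \<comment> \<open>At \<open>x = 0\<close> the exponential is 1, so \<open>G\<close> expands
    \<open>1 / mgf \<mu> (u z)\<close>. Its constant term is \<open>P 0\<close>, hence 1, which
    makes it invertible.\<close>
  define G where "G = H 0"
  have G0: "fps_nth G 0 \<noteq> 0"
    by (simp add: G_def H_def P0)
  have H: "H x = (fps_exp x oo U) * G" for x
  proof -
    have "(\<lambda>z. exp (0 * u z) / mgf \<mu> (u z)) has_fps_expansion G"
      using exp[of 0] by (simp add: G_def H_def)
    then have G: "(\<lambda>z. 1 / mgf \<mu> (u z)) has_fps_expansion G"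
      by simp
    have "isCont (\<lambda>z. 1 / mgf \<mu> (u z)) 0"
      using has_fps_expansion_imp_continuous[OF G, where A = UNIV] by simp
    moreover have "1 / mgf \<mu> (u 0) \<noteq> 0"
      using has_fps_expansion_at_0[OF G] G0 by simp
    ultimately have "eventually (\<lambda>z. 1 / mgf \<mu> (u z) \<noteq> 0) (at 0)"
      unfolding isCont_def by (rule tendsto_imp_eventually_ne)
    \<comment> \<open>The exponential is recovered only where the denominator does not degenerate;
      continuity at 0 ensures this nearby.\<close>
    then have "eventually (\<lambda>z. exp (x * u z) / mgf \<mu> (u z) * inverse (1 / mgf \<mu> (u z)) = exp (x * u z)) (nhds 0)"
      using \<open>1 / mgf \<mu> (u 0) \<noteq> 0\<close> unfolding eventually_at_filter
      by (auto elim!: eventually_mono)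
    moreover have "(\<lambda>z. exp (x * u z) / mgf \<mu> (u z) * inverse (1 / mgf \<mu> (u z))) has_fps_expansion H x * inverse G"
      using exp[of x] G G0 by (intro has_fps_expansion_mult has_fps_expansion_inverse) (simp_all add: H_def)
    ultimately have "(\<lambda>z. exp (x * u z)) has_fps_expansion H x * inverse G"
      by (rule has_fps_expansion_cong)
    from has_fps_expansion_exp_compose[OF u u0 this]
    have "(fps_exp x oo U) * G = H x * (inverse G * G)"
      by (simp add: mult.assoc)
    then show ?thesis
      using inverse_mult_eq_1[OF G0] by simp
  qed
  have "(moment_fps \<mu> oo U) * G = Abs_fps (\<lambda>n. LINT x|\<mu>. fps_nth (H x) n)"
    using integral_power_mult_fps_exp_compose[of 0 U G] by (simp add: H moment_fps_def)
  also have "\<dots> = 1"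
    by (rule fps_ext) (simp add: H_def int_P)
  finally have MG: "(moment_fps \<mu> oo U) * G = 1" .
  have "(fps_deriv (moment_fps \<mu>) oo U) * G = Abs_fps (\<lambda>n. LINT x|\<mu>. x * fps_nth (H x) n)"
    using integral_power_mult_fps_exp_compose[of 1 U G] by (simp add: H fps_deriv_moment_fps)
  also have "\<dots> = fps_const m + fps_const v * fps_X"
    by (rule fps_ext) (simp add: H_def int_xP fps_X_def)
  finally have DG: "(fps_deriv (moment_fps \<mu>) oo U) * G = fps_const m + fps_const v * fps_X" .
  \<comment> \<open>By \<open>MG\<close>, \<open>G\<close> is the inverse of the composed moment
    series, so \<open>DG\<close> can be solved for the derivative.\<close>
  have "fps_deriv (moment_fps \<mu>) oo U
      = (fps_deriv (moment_fps \<mu>) oo U) * ((moment_fps \<mu> oo U) * G)"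
    by (simp only: MG mult_1_right)
  also have "\<dots> = (fps_deriv (moment_fps \<mu>) oo U) * G * (moment_fps \<mu> oo U)"
    by (simp only: mult_ac)
  finally show ?thesis
    by (simp only: DG)
qed

lemma (in real_distribution) moment_fps_0: "fps_nth (moment_fps M) 0 = 1"
  using prob_space by (simp add: moment_fps_def)

text \<open>Doubling mean and variance doubles the logarithmic derivative of the moment series,
  which is what squaring does as well.\<close>

lemma meixner_class_moment_fps_double:
  assumes u: "u has_fps_expansion U" and u0: "u 0 = 0" and U1: "fps_nth U 1 \<noteq> 0"
    and \<mu>: "\<mu> \<in> meixner_class u" and \<mu>': "\<mu>' \<in> meixner_class u"
    and r: "meixner_param \<mu>' = 2 *\<^sub>R meixner_param \<mu>"
  shows "moment_fps \<mu>' = (moment_fps \<mu>)\<^sup>2"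
proof -
  have U0: "fps_nth U 0 = 0"
    using has_fps_expansion_at_0[OF u] u0 by simp
  interpret \<mu>: real_distribution \<mu>
    using \<mu> by (simp add: meixner_class_def)
  interpret \<mu>': real_distribution \<mu>'
    using \<mu>' by (simp add: meixner_class_def)
  obtain m v where mv: "meixner_param \<mu> = (m, v)"
    by (cases "meixner_param \<mu>")
  with r have mv': "meixner_param \<mu>' = (2 * m, 2 * v)"
    by simp
  define A where "A = moment_fps \<mu> oo U"
  \<comment> \<open>The prime refers to the second law \<open>\<mu>'\<close>, not to a
    derivative.\<close>
  define A' where "A' = moment_fps \<mu>' oo U"
  have const2: "fps_const (2 * c) = 2 * fps_const c" for c :: real
    by (simp add: fps_numeral_fps_const)
  have "A' = A\<^sup>2"
  proof (rule fps_linear_ode_unique)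
    define C where "C = (fps_const m + fps_const v * fps_X) * fps_deriv U"
    have "fps_deriv A = C * A"
      by (simp add: A_def C_def fps_compose_deriv[OF U0] mult_ac
            meixner_class_moment_fps_deriv[OF \<mu> u u0 mv])
    then show "fps_deriv (A\<^sup>2) = 2 * C * A\<^sup>2"
      by (simp add: power2_eq_square algebra_simps)
    show "fps_deriv A' = 2 * C * A'"
      unfolding A'_def C_def fps_compose_deriv[OF U0]
        meixner_class_moment_fps_deriv[OF \<mu>' u u0 mv'] const2
      by (simp add: algebra_simps)
  qed (simp_all add: A_def A'_def power2_eq_square \<mu>.moment_fps_0 \<mu>'.moment_fps_0)
  \<comment> \<open>Composition with a nonzero series without constant term is injective, so
    \<open>U\<close> can be cancelled.\<close>
  then have "(moment_fps \<mu>' - (moment_fps \<mu>)\<^sup>2) oo U = 0"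
    by (simp add: A_def A'_def fps_compose_sub_distrib fps_compose_power[OF U0])
  moreover have "U \<noteq> 0"
    using U1 by auto
  ultimately show ?thesis
    using U0 by (simp add: fps_compose_eq_0_iff)
qed

section \<open>Convolution and convolution roots\<close>

text \<open>Stated with values in the extended nonnegative reals, so that it applies before
  integrability under either factor is known.\<close>

lemma nn_integral_exp_convolution:
  assumes "real_distribution \<mu>" "real_distribution \<nu>"
  shows "(\<integral>\<^sup>+x. ennreal (exp (t * x)) \<partial>(\<mu> \<star> \<nu>))
    = (\<integral>\<^sup>+x. ennreal (exp (t * x)) \<partial>\<mu>) * (\<integral>\<^sup>+x. ennreal (exp (t * x)) \<partial>\<nu>)"
proof -
  interpret \<mu>: real_distribution \<mu> by fact
  interpret \<nu>: real_distribution \<nu> by fact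
  have "(\<integral>\<^sup>+x. ennreal (exp (t * x)) \<partial>(\<mu> \<star> \<nu>))
      = (\<integral>\<^sup>+x. \<integral>\<^sup>+y. ennreal (exp (t * x)) * ennreal (exp (t * y)) \<partial>\<nu> \<partial>\<mu>)"
    by (subst nn_integral_convolution)
       (auto intro: \<mu>.finite_measure_axioms \<nu>.finite_measure_axioms
         simp: distrib_left exp_add ennreal_mult)
  then show ?thesis
    by (simp add: nn_integral_cmult nn_integral_multc)
qed

text \<open>This holds for every \<open>t\<close>: \<open>enn2real\<close> sends infinity to 0,
  which matches the default value 0 of a divergent integral.\<close>

lemma mgf_convolution:
  assumes "real_distribution \<mu>" "real_distribution \<nu>"
  shows "mgf (\<mu> \<star> \<nu>) t = mgf \<mu> t * mgf \<nu> t"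
proof -
  interpret \<mu>: real_distribution \<mu> by fact
  interpret \<nu>: real_distribution \<nu> by fact
  show ?thesis
    unfolding mgf_def
    by (simp add: integral_eq_nn_integral nn_integral_exp_convolution[OF assms] enn2real_mult)
qed

text \<open>The integral under the convolution square is the square of the integral under
  \<open>\<nu>\<close>, and the square of infinity is infinite.\<close>

lemma exp_moments_convolution_root:
  assumes \<nu>: "real_distribution \<nu>" and conv: "exp_moments (\<nu> \<star> \<nu>) \<epsilon>"
  shows "exp_moments \<nu> \<epsilon>"
proof -
  interpret \<nu>: real_distribution \<nu> by fact
  interpret conv: exp_moments "\<nu> \<star> \<nu>" \<epsilon> by fact
  show ?thesis
  proof (unfold_locales, rule conv.eps_pos)
    fix t :: real
    assume "\<bar>t\<bar> < \<epsilon>"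
    then have "(\<integral>\<^sup>+x. ennreal (exp (t * x)) \<partial>(\<nu> \<star> \<nu>)) < \<infinity>"
      using conv.integrable_exp[of t] by (simp add: integrable_iff_bounded)
    then have "(\<integral>\<^sup>+x. ennreal (exp (t * x)) \<partial>\<nu>) < \<infinity>"
      unfolding nn_integral_exp_convolution[OF \<nu> \<nu>]
      by (cases "\<integral>\<^sup>+x. ennreal (exp (t * x)) \<partial>\<nu>") (auto simp: ennreal_top_mult)
    then show "integrable \<nu> (\<lambda>x. exp (t * x))"
      by (simp add: integrable_iff_bounded)
  qed
qed

theorem theorem1:
  fixes u :: "real \<Rightarrow> real" and r :: "real \<times> real" and \<mu>\<^sub>1 \<mu>\<^sub>2 \<nu> :: "real measure"
  assumes u_expansion: "\<exists>F. u has_fps_expansion F"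
    and u_0: "u 0 = 0"
    and u_deriv: "(u has_real_derivative 1) (at 0)"
    and mu1: "\<mu>\<^sub>1 \<in> meixner_class u" "meixner_param \<mu>\<^sub>1 = r"
    and mu2: "\<mu>\<^sub>2 \<in> meixner_class u" "meixner_param \<mu>\<^sub>2 = 2 *\<^sub>R r"
    and nu: "real_distribution \<nu>"
    and mu2_eq: "\<mu>\<^sub>2 = (\<nu> \<star> \<nu>)"
    and nu_ac: "absolutely_continuous \<mu>\<^sub>1 \<nu>"
    and nu_sq: "(\<integral>\<^sup>+x. (RN_deriv \<mu>\<^sub>1 \<nu> x)\<^sup>2 \<partial>\<mu>\<^sub>1) < \<infinity>"
  shows "\<nu> = \<mu>\<^sub>1 \<and> \<nu> \<in> meixner_class u"
proof -
  obtain U where U: "u has_fps_expansion U"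
    using u_expansion by blast
  have "fps_nth U 1 = 1"
    using has_fps_expansion_at_0[OF has_fps_expansion_deriv[OF U]] DERIV_imp_deriv[OF u_deriv] by simp
  then have double: "moment_fps \<mu>\<^sub>2 = (moment_fps \<mu>\<^sub>1)\<^sup>2"
    using meixner_class_moment_fps_double[OF U u_0 _ mu1(1) mu2(1)] mu1(2) mu2(2) by simp
  obtain \<epsilon>\<^sub>1 \<epsilon>\<^sub>2 where "exp_moments \<mu>\<^sub>1 \<epsilon>\<^sub>1" and mom2: "exp_moments \<mu>\<^sub>2 \<epsilon>\<^sub>2"
    using meixner_class_exp_moments[OF mu1(1)] meixner_class_exp_moments[OF mu2(1)] by metis
  interpret \<mu>\<^sub>1: exp_moments \<mu>\<^sub>1 \<epsilon>\<^sub>1 by fact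
  interpret \<mu>\<^sub>2: exp_moments \<mu>\<^sub>2 \<epsilon>\<^sub>2 by fact
  interpret \<nu>: exp_moments \<nu> \<epsilon>\<^sub>2
    using exp_moments_convolution_root[OF nu] mom2 mu2_eq by simp
  have "mgf \<mu>\<^sub>2 = (\<lambda>t. mgf \<nu> t * mgf \<nu> t)"
    using mgf_convolution[OF nu nu] mu2_eq by auto
  then have "mgf \<mu>\<^sub>2 has_fps_expansion moment_fps \<nu> * moment_fps \<nu>"
    using has_fps_expansion_mult[OF \<nu>.mgf_has_fps_expansion \<nu>.mgf_has_fps_expansion] by simp
  then have "moment_fps \<mu>\<^sub>2 = (moment_fps \<nu>)\<^sup>2"
    using fps_expansion_unique[OF \<mu>\<^sub>2.mgf_has_fps_expansion] by (simp add: power2_eq_square)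
  \<comment> \<open>Real formal power series form an integral domain, so square roots agree up to
    sign; the constant term 1 then fixes the sign.\<close>
  then have "moment_fps \<nu> = moment_fps \<mu>\<^sub>1 \<or> moment_fps \<nu> = - moment_fps \<mu>\<^sub>1"
    using double by (auto simp: power2_eq_iff)
  moreover have "moment_fps \<nu> \<noteq> - moment_fps \<mu>\<^sub>1"
    using \<nu>.moment_fps_0 \<mu>\<^sub>1.moment_fps_0 by (metis fps_neg_nth one_neq_neg_one)
  ultimately have "moment_fps \<nu> = moment_fps \<mu>\<^sub>1"
    by blast
  \<comment> \<open>The comparison of the two laws requires a common radius.\<close>
  moreover have "exp_moments \<nu> (min \<epsilon>\<^sub>1 \<epsilon>\<^sub>2)" "exp_moments \<mu>\<^sub>1 (min \<epsilon>\<^sub>1 \<epsilon>\<^sub>2)"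
    using \<mu>\<^sub>1.eps_pos \<mu>\<^sub>2.eps_pos
    by (auto intro: exp_moments_mono[OF \<nu>.exp_moments_axioms] exp_moments_mono[OF \<mu>\<^sub>1.exp_moments_axioms])
  ultimately have "\<nu> = \<mu>\<^sub>1"
    using exp_moments_eqI by blast
  with mu1(1) show ?thesis
    by simp
qed

end
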